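(* Let $Y$ be a real random variable whose moment generating function $E[e^{tY}]$ exists for $|t|<r$, for some $r>0$. Let $(Y_j)_{j\ge 1}$ be mutually independent copies of $Y$, and let $S_0=0$, $S_k=Y_1+\cdots+Y_k$ for $k\ge 1$. Then for any integer $n\ge 0$ and every real $x$, $$B_{n}^{(L,Y)}(x)=e^{-x}\sum_{k=0}^{\infty}\frac{x^{k}}{k!}E\big[\langle S_{k}\rangle_{n}\big].$$
   Context: Rising factorial: $\langle x\rangle_0=1$, $\langle x\rangle_n=x(x+1)\cdots(x+n-1)$ for $n\ge 1$. The probabilistic Lah numbers $L_Y(n,k)$ ($n\ge k\ge 0$) associated with $Y$ are defined by the power series expansion about $t=0$ $$\frac{1}{k!}\left(E\left[\left(\frac{1}{1-t}\right)^{Y}\right]-1\right)^{k}=\sum_{n=k}^{\infty}L_{Y}(n,k)\frac{t^{n}}{n!},\quad k\ge 0.$$ The probabilistic Lah-Bell polynomials associated with $Y$ are $B_{n}^{(L,Y)}(x)=\sum_{k=0}^{n}L_{Y}(n,k)x^{k}$, $n\ge 0$. *)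

theory Defs
  imports "HOL-Probability.Probability"
begin

text \<open>
  The exponential coefficients in the expansion about \<open>t = 0\<close> of
  \<open>(E[(1/(1-t))\<^sup>Y] - 1)\<^sup>k / k!\<close>. The expansion is only required to hold on some
  neighbourhood of \<open>0\<close>; by uniqueness of power series coefficients there is at most one such
  sequence. The series starts at \<open>n = k\<close>, so \<open>L\<^sub>Y(n,k)\<close> is \<open>0\<close> for \<open>n < k\<close>.
\<close>

definition prob_Lah :: "'a measure \<Rightarrow> ('a \<Rightarrow> real) \<Rightarrow> nat \<Rightarrow> nat \<Rightarrow> real" where
  "prob_Lah M Y n k =
     (THE a :: nat \<Rightarrow> real.
        (\<forall>m<k. a m = 0) \<and>
        (\<exists>\<delta>>0. \<forall>t::real. \<bar>t\<bar> < \<delta> \<longrightarrow>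
           (\<lambda>m. a m * t ^ m / fact m) sums
             (1 / fact k * ((\<integral>\<omega>. (1 / (1 - t)) powr Y \<omega> \<partial>M) - 1) ^ k))) n"

definition prob_Lah_Bell :: "'a measure \<Rightarrow> ('a \<Rightarrow> real) \<Rightarrow> nat \<Rightarrow> real \<Rightarrow> real" where
  "prob_Lah_Bell M Y n x = (\<Sum>k=0..n. prob_Lah M Y n k * x ^ k)"

end

theory Submission
  imports Defs
begin

text \<open>
  Let \<open>F(t) = \<Sum>\<^sub>m E[\<langle>Y\<rangle>\<^sub>m] t\<^sup>m / m!\<close>. By dominated convergence \<open>F\<close> is the expansion of
  \<open>E[(1/(1-t))\<^sup>Y]\<close> about \<open>0\<close>, so \<open>L\<^sub>Y(n,k) = n!/k! [t\<^sup>n] (F - 1)\<^sup>k\<close>. The Vandermonde identity for rising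
  factorials and independence give \<open>E[\<langle>S\<^sub>k\<rangle>\<^sub>n] = n! [t\<^sup>n] F\<^sup>k\<close>. Expanding \<open>F\<^sup>k = (1 + (F - 1))\<^sup>k\<close>
  binomially, only the powers \<open>(F - 1)\<^sup>j\<close> with \<open>j \<le> n\<close> contribute to the coefficient of \<open>t\<^sup>n\<close>, and
  \<open>\<Sum>\<^sub>k x\<^sup>k/k! (k choose j) = e\<^sup>x x\<^sup>j/j!\<close> finishes the proof.
\<close>

unbundle no vec_syntax
unbundle fps_syntax

section \<open>Rising factorials, the binomial series and uniqueness of coefficients\<close>

text \<open>Newton's binomial series with exponent \<open>- y\<close> and argument
  \<open>- t\<close>: the sign relating \<open>- y gchoose m\<close> to the rising factorial cancels
  the one in \<open>(- t) ^ m\<close>.\<close>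

lemma sums_pochhammer_powr:
  fixes t y :: real
  assumes "\<bar>t\<bar> < 1"
  shows "(\<lambda>m. pochhammer y m / fact m * t ^ m) sums (1 / (1 - t)) powr y"
proof -
  have "(\<lambda>m. (- y gchoose m) * (- t) ^ m) sums (1 + - t) powr (- y)"
    using assms by (intro gen_binomial_real) simp
  moreover have "(- y gchoose m) * (- t) ^ m = pochhammer y m / fact m * t ^ m" for m
  proof -
    have "(- 1) ^ m * (- 1 :: real) ^ m = 1"
      by (simp flip: power_mult_distrib)
    thus ?thesis
      by (simp add: gbinomial_pochhammer power_minus[of t])
  qed
  moreover have "(1 + - t) powr (- y) = (1 / (1 - t)) powr y"
    using assms by (simp add: powr_minus_divide powr_divide)
  ultimately show ?thesis by simp
qed

text \<open>Factor by factor, the triangle inequality bounds \<open>y + i\<close> by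
  \<open>\<bar>y\<bar> + i\<close>. This lets the series for \<open>\<bar>Y\<bar>\<close> dominate
  the one for \<open>Y\<close>.\<close>

lemma abs_pochhammer_le: "\<bar>pochhammer y m\<bar> \<le> pochhammer \<bar>y\<bar> m" for y :: real
  unfolding pochhammer_prod abs_prod by (intro prod_mono) auto

lemma pochhammer_abs_nonneg [simp]: "0 \<le> pochhammer \<bar>y\<bar> m" for y :: real
  by (rule order_trans[OF abs_ge_zero abs_pochhammer_le])

lemma borel_measurable_pochhammer [measurable (raw)]:
  fixes f :: "'a \<Rightarrow> real"
  assumes [measurable]: "f \<in> borel_measurable M"
  shows "(\<lambda>\<omega>. pochhammer (f \<omega>) m) \<in> borel_measurable M"
  unfolding pochhammer_prod by measurable

text \<open>Strong induction: once the coefficients below \<open>n\<close> vanish, dividing by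
  \<open>t ^ n\<close> leaves a series that sums to 0 for small \<open>t \<noteq> 0\<close> and
  tends to its constant term \<open>c n\<close> as \<open>t\<close> tends to 0.\<close>

lemma powser_eq_0_imp_coeff_eq_0:
  fixes c :: "nat \<Rightarrow> real"
  assumes "\<delta> > 0" and sums: "\<And>t. \<bar>t\<bar> < \<delta> \<Longrightarrow> (\<lambda>m. c m * t ^ m) sums 0"
  shows "c n = 0"
proof (induction n rule: less_induct)
  case (less n)
  have "((\<lambda>_::real. 0::real) \<longlongrightarrow> c (0 + n)) (at 0)"
  proof (rule powser_limit_0_strong[where a = "\<lambda>m. c (m + n)", OF \<open>\<delta> > 0\<close>])
    fix t :: real assume t: "t \<noteq> 0" "norm t < \<delta>"
    have "(\<lambda>m. c (m + n) * t ^ (m + n)) sums (0 - (\<Sum>m<n. c m * t ^ m))"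
      using sums[of t] t by (intro sums_split_initial_segment) simp_all
    also have "(\<Sum>m<n. c m * t ^ m) = 0"
      using less by (intro sum.neutral) auto
    finally have "(\<lambda>m. c (m + n) * t ^ (m + n) / t ^ n) sums (0 / t ^ n)"
      by (intro sums_divide) simp
    thus "(\<lambda>m. c (m + n) * t ^ m) sums 0"
      using t by (simp add: power_add)
  qed
  thus ?case
    using tendsto_unique[OF _ tendsto_const, of "at (0::real)"] by fastforce
qed

section \<open>Expectation of the binomial series\<close>

text \<open>The dominating function is \<open>(1 - \<bar>t\<bar>)\<^bsup>-\<bar>Y\<bar>\<^esup> = e\<^bsup>c\<bar>Y\<bar>\<^esup>\<close> with \<open>c = - ln (1 - \<bar>t\<bar>) < r\<close>.\<close>

lemma
  fixes Y :: "'a \<Rightarrow> real" and r t :: real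
  assumes [measurable]: "Y \<in> borel_measurable M"
    and "r > 0"
    and mgf: "\<And>t::real. \<bar>t\<bar> < r \<Longrightarrow> integrable M (\<lambda>\<omega>. exp (t * Y \<omega>))"
  shows integrable_pochhammer: "integrable M (\<lambda>\<omega>. pochhammer (Y \<omega>) m)"
    and sums_expectation_pochhammer: "\<bar>t\<bar> < 1 - exp (- r) \<Longrightarrow>
      (\<lambda>m. (\<integral>\<omega>. pochhammer (Y \<omega>) m \<partial>M) / fact m * t ^ m) sums
        (\<integral>\<omega>. (1 / (1 - t)) powr Y \<omega> \<partial>M)"
proof -
  define D where "D t \<omega> = (1 / (1 - \<bar>t\<bar>)) powr \<bar>Y \<omega>\<bar>" for t \<omega>
  have lt1: "\<bar>t\<bar> < 1" if "\<bar>t\<bar> < 1 - exp (- r)" for t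
    using that exp_gt_zero[of "-r"] by linarith
  have D_int: "integrable M (D t)" if t: "\<bar>t\<bar> < 1 - exp (- r)" for t
  proof (rule Bochner_Integration.integrable_bound)
    define c where "c = - ln (1 - \<bar>t\<bar>)"
    \<comment> \<open>The radius \<open>1 - exp (- r)\<close> is chosen so that
      \<open>c < r\<close>, which keeps both \<open>c\<close> and \<open>- c\<close> in the range of
      the moment generating function.\<close>
    have "ln (exp (- r)) < ln (1 - \<bar>t\<bar>)"
      using t by (subst ln_less_cancel_iff) (auto simp: lt1)
    hence c: "0 \<le> c" "c < r"
      using lt1[OF t] by (auto simp: c_def)
    show "integrable M (\<lambda>\<omega>. exp (c * Y \<omega>) + exp (- c * Y \<omega>))"
      using c by (intro Bochner_Integration.integrable_add mgf) auto
    have "D t \<omega> = exp (c * \<bar>Y \<omega>\<bar>)" for \<omega>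
      using lt1[OF t] by (simp add: D_def powr_def c_def ln_div mult.commute)
    \<comment> \<open>According to the sign of \<open>y\<close>, one of the two summands equals the
      left side.\<close>
    moreover have "exp (c * \<bar>y\<bar>) \<le> exp (c * y) + exp (- c * y)" for y
      by (cases "y \<ge> 0") auto
    ultimately show "AE \<omega> in M. norm (D t \<omega>) \<le> norm (exp (c * Y \<omega>) + exp (- c * Y \<omega>))"
      by (auto simp: abs_of_pos add_pos_pos)
  qed (simp add: D_def[abs_def])
  have D_sums: "(\<lambda>m. pochhammer \<bar>Y \<omega>\<bar> m / fact m * \<bar>t\<bar> ^ m) sums D t \<omega>"
    if "\<bar>t\<bar> < 1 - exp (- r)" for t \<omega>
    unfolding D_def using lt1[OF that] by (intro sums_pochhammer_powr) simp
  have term_le: "norm (pochhammer (Y \<omega>) m / fact m * t ^ m)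
      \<le> pochhammer \<bar>Y \<omega>\<bar> m / fact m * \<bar>t\<bar> ^ m" for t \<omega> m
    by (simp add: abs_mult power_abs mult_right_mono divide_right_mono abs_pochhammer_le)
  \<comment> \<open>Used twice over: a singleton \<open>I\<close> gives integrability of each term,
    and general \<open>I\<close> bounds the partial sums needed to integrate termwise.\<close>
  have sum_le: "(\<Sum>i\<in>I. norm (pochhammer (Y \<omega>) i / fact i * t ^ i)) \<le> D t \<omega>"
    if "\<bar>t\<bar> < 1 - exp (- r)" "finite I" for t \<omega> I
  proof -
    have "(\<Sum>i\<in>I. norm (pochhammer (Y \<omega>) i / fact i * t ^ i))
        \<le> (\<Sum>i\<in>I. pochhammer \<bar>Y \<omega>\<bar> i / fact i * \<bar>t\<bar> ^ i)"
      by (intro sum_mono term_le)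
    also have "\<dots> \<le> D t \<omega>"
      unfolding sums_unique[OF D_sums[OF that(1)]]
      by (intro sum_le_suminf sums_summable[OF D_sums] that) auto
    finally show ?thesis .
  qed
  have term_int: "integrable M (\<lambda>\<omega>. pochhammer (Y \<omega>) m / fact m * t ^ m)"
    if "\<bar>t\<bar> < 1 - exp (- r)" for t m
  proof (rule Bochner_Integration.integrable_bound[OF D_int[OF that]])
    show "AE \<omega> in M. norm (pochhammer (Y \<omega>) m / fact m * t ^ m) \<le> norm (D t \<omega>)"
      using sum_le[OF that, of "{m}"] by (auto intro: order_trans[OF _ abs_ge_self])
  qed measurable
  \<comment> \<open>Any nonzero point inside the radius would do: the \<open>m\<close>-th term is
    integrable there, and rescaling by \<open>fact m / s ^ m\<close> leaves the rising factorial
    alone.\<close>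
  define s where "s = (1 - exp (- r)) / 2"
  have s: "s \<noteq> 0" "\<bar>s\<bar> < 1 - exp (- r)"
    using \<open>r > 0\<close> by (auto simp: s_def)
  from integrable_mult_left[OF term_int[OF s(2), of m], of "fact m / s ^ m"] s(1)
  show "integrable M (\<lambda>\<omega>. pochhammer (Y \<omega>) m)"
    by simp
  assume t: "\<bar>t\<bar> < 1 - exp (- r)"
  let ?f = "\<lambda>m \<omega>. pochhammer (Y \<omega>) m / fact m * t ^ m"
  have "(\<lambda>m. integral\<^sup>L M (?f m)) sums (\<integral>\<omega>. (\<Sum>m. ?f m \<omega>) \<partial>M)"
  proof (rule sums_integral)
    show "AE \<omega> in M. summable (\<lambda>m. norm (?f m \<omega>))"
      using sum_le[OF t] by (intro AE_I2 summableI_nonneg_bounded) auto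
    \<comment> \<open>The partial sums of the integrated norms stay below the integral of
      \<open>D t\<close>.\<close>
    show "summable (\<lambda>m. \<integral>\<omega>. norm (?f m \<omega>) \<partial>M)"
    proof (rule summableI_nonneg_bounded)
      fix k
      have "(\<Sum>m<k. \<integral>\<omega>. norm (?f m \<omega>) \<partial>M) = (\<integral>\<omega>. (\<Sum>m<k. norm (?f m \<omega>)) \<partial>M)"
        using term_int[OF t] by (intro Bochner_Integration.integral_sum[symmetric] integrable_norm)
      also have "\<dots> \<le> (\<integral>\<omega>. D t \<omega> \<partial>M)"
        using sum_le[OF t] term_int[OF t]
        by (intro integral_mono D_int[OF t] Bochner_Integration.integrable_sum integrable_norm) auto
      finally show "(\<Sum>m<k. \<integral>\<omega>. norm (?f m \<omega>) \<partial>M) \<le> (\<integral>\<omega>. D t \<omega> \<partial>M)" .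
    qed simp
  qed (rule term_int[OF t])
  also have "(\<lambda>\<omega>. \<Sum>m. ?f m \<omega>) = (\<lambda>\<omega>. (1 / (1 - t)) powr Y \<omega>)"
    using sums_pochhammer_powr[OF lt1[OF t]] by (auto simp: sums_iff)
  finally show "(\<lambda>m. (\<integral>\<omega>. pochhammer (Y \<omega>) m \<partial>M) / fact m * t ^ m) sums
        (\<integral>\<omega>. (1 / (1 - t)) powr Y \<omega> \<partial>M)"
    by simp
qed

section \<open>Lah numbers as coefficients of formal power series\<close>

text \<open>Inside the disc of convergence, evaluating a formal power series commutes with
  subtraction and powers, so the coefficients of \<open>(F - 1) ^ k\<close> give the required
  expansion. Since \<open>F - 1\<close> has no constant term, they vanish below index
  \<open>k\<close>.\<close>

lemma prob_Lah_eq_fps_nth: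
  fixes F :: "real fps"
  assumes "\<delta> > 0" and "F $ 0 = 1"
    and F: "\<And>t. \<bar>t\<bar> < \<delta> \<Longrightarrow> (\<lambda>m. F $ m * t ^ m) sums (\<integral>\<omega>. (1 / (1 - t)) powr Y \<omega> \<partial>M)"
  shows "prob_Lah M Y n k = fact n / fact k * ((F - 1) ^ k) $ n"
proof -
  let ?E = "\<lambda>t. \<integral>\<omega>. (1 / (1 - t)) powr Y \<omega> \<partial>M"
  let ?a = "\<lambda>m. fact m / fact k * ((F - 1) ^ k) $ m"
  have "fps_conv_radius F \<ge> ereal \<delta>"
    unfolding fps_conv_radius_def
    by (intro conv_radius_geI_ex') (auto intro!: sums_summable[OF F])
  hence rad: "ereal (norm t) < fps_conv_radius F" if "\<bar>t\<bar> < \<delta>" for t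
    using that by (auto intro: less_le_trans[of _ "ereal \<delta>"])
  have "(\<lambda>m. ?a m * t ^ m / fact m) sums (1 / fact k * (?E t - 1) ^ k)" if t: "\<bar>t\<bar> < \<delta>" for t
  proof -
    have rad1: "ereal (norm t) < fps_conv_radius (F - 1)"
      using rad[OF t] fps_conv_radius_diff[of F 1] by (simp add: order_less_le_trans)
    have "eval_fps F t = ?E t"
      using F[OF t] by (simp add: eval_fps_def sums_iff)
    hence "eval_fps ((F - 1) ^ k) t = (?E t - 1) ^ k"
      using rad[OF t] rad1 by (simp add: eval_fps_power eval_fps_diff)
    moreover have "(\<lambda>m. ((F - 1) ^ k) $ m * t ^ m) sums eval_fps ((F - 1) ^ k) t"
      by (rule sums_eval_fps, rule order_less_le_trans[OF rad1 fps_conv_radius_power])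
    ultimately have "(\<lambda>m. 1 / fact k * (((F - 1) ^ k) $ m * t ^ m)) sums (1 / fact k * (?E t - 1) ^ k)"
      by (intro sums_mult) simp
    thus ?thesis by (simp add: field_simps)
  qed
  note a_sums = this
  have "(THE a. (\<forall>m<k. a m = 0) \<and> (\<exists>\<delta>>0. \<forall>t. \<bar>t\<bar> < \<delta> \<longrightarrow>
      (\<lambda>m. a m * t ^ m / fact m) sums (1 / fact k * (?E t - 1) ^ k))) = ?a"
  proof (rule the_equality)
    show "(\<forall>m<k. ?a m = 0) \<and> (\<exists>\<delta>>0. \<forall>t. \<bar>t\<bar> < \<delta> \<longrightarrow>
        (\<lambda>m. ?a m * t ^ m / fact m) sums (1 / fact k * (?E t - 1) ^ k))"
      using a_sums \<open>\<delta> > 0\<close> startsby_zero_power_prefix[of "F - 1" k] \<open>F $ 0 = 1\<close> by auto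
  next
    fix a
    assume "(\<forall>m<k. a m = 0) \<and> (\<exists>\<delta>>0. \<forall>t. \<bar>t\<bar> < \<delta> \<longrightarrow>
        (\<lambda>m. a m * t ^ m / fact m) sums (1 / fact k * (?E t - 1) ^ k))"
    then obtain \<delta>' where \<delta>': "\<delta>' > 0" and
      a: "\<And>t. \<bar>t\<bar> < \<delta>' \<Longrightarrow> (\<lambda>m. a m * t ^ m / fact m) sums (1 / fact k * (?E t - 1) ^ k)"
      by blast
    \<comment> \<open>Both expansions hold on the smaller neighbourhood, where their difference is a
      power series with sum 0.\<close>
    have "(a m - ?a m) / fact m = 0" for m
    proof (rule powser_eq_0_imp_coeff_eq_0)
      show "0 < min \<delta> \<delta>'" using \<open>\<delta> > 0\<close> \<delta>' by simp
      show "(\<lambda>m. (a m - ?a m) / fact m * t ^ m) sums 0" if "\<bar>t\<bar> < min \<delta> \<delta>'" for t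
        using sums_diff[OF a a_sums, of t t] that
        by (simp add: left_diff_distrib diff_divide_distrib)
    qed
    thus "a = ?a" by auto
  qed
  thus ?thesis unfolding prob_Lah_def by simp
qed

section \<open>Rising factorial moments of sums of independent copies\<close>

context prob_space
begin

lemma
  assumes Y: "Y \<in> borel_measurable M"
    and indep: "indep_vars (\<lambda>_. borel) Ys {1..}"
    and distr: "\<And>j. j \<ge> 1 \<Longrightarrow> distr M borel (Ys j) = distr M borel Y"
    and int: "\<And>m. integrable M (\<lambda>\<omega>. pochhammer (Y \<omega> :: real) m)"
  shows integrable_pochhammer_sum: "integrable M (\<lambda>\<omega>. pochhammer (\<Sum>j=1..k. Ys j \<omega>) m)"
    and expectation_pochhammer_sum:
      "expectation (\<lambda>\<omega>. pochhammer (\<Sum>j=1..k. Ys j \<omega>) m) =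
       fact m * (Abs_fps (\<lambda>m. expectation (\<lambda>\<omega>. pochhammer (Y \<omega>) m) / fact m) ^ k) $ m"
proof -
  let ?F = "Abs_fps (\<lambda>m. expectation (\<lambda>\<omega>. pochhammer (Y \<omega>) m) / fact m)"
  have meas: "random_variable borel (Ys j)" if "j \<ge> 1" for j
    using indep that by (auto simp: indep_vars_def)
  have Ys_int: "integrable M (\<lambda>\<omega>. pochhammer (Ys j \<omega>) m)"
    and Ys_exp: "expectation (\<lambda>\<omega>. pochhammer (Ys j \<omega>) m) = fact m * ?F $ m" if j: "j \<ge> 1" for j m
  proof -
    have poch: "(\<lambda>y::real. pochhammer y m) \<in> borel_measurable borel" by measurable
    show "integrable M (\<lambda>\<omega>. pochhammer (Ys j \<omega>) m)"
      using int[of m] integrable_distr_eq[OF Y poch] integrable_distr_eq[OF meas[OF j] poch]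
        distr[OF j] by simp
    show "expectation (\<lambda>\<omega>. pochhammer (Ys j \<omega>) m) = fact m * ?F $ m"
      using integral_distr[OF Y poch] integral_distr[OF meas[OF j] poch] distr[OF j] by simp
  qed
  have "integrable M (\<lambda>\<omega>. pochhammer (\<Sum>j=1..k. Ys j \<omega>) m) \<and>
      expectation (\<lambda>\<omega>. pochhammer (\<Sum>j=1..k. Ys j \<omega>) m) = fact m * (?F ^ k) $ m"
  \<comment> \<open>The convolution calls on all orders \<open>m - i\<close>, hence the general
    \<open>m\<close>. Integrability is carried along because the product rule for expectations
    requires it.\<close>
  proof (induction k arbitrary: m)
    \<comment> \<open>For the empty sum, \<open>pochhammer 0 m\<close> is 1 at \<open>m = 0\<close>
      and 0 otherwise, just like the coefficients of \<open>?F ^ 0\<close>.\<close>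
    case 0
    show ?case by (cases m) (auto simp: prob_space pochhammer_rec)
  next
    case (Suc k)
    let ?S = "\<lambda>\<omega>. \<Sum>j=1..k. Ys j \<omega>"
    let ?g = "\<lambda>i \<omega>. pochhammer (Ys (Suc k) \<omega>) i * pochhammer (?S \<omega>) (m - i)"
    have "indep_var borel (Ys (Suc k)) borel ?S"
      by (intro indep_vars_sum indep_vars_subset[OF indep]) auto
    hence ind: "indep_var borel (\<lambda>\<omega>. pochhammer (Ys (Suc k) \<omega>) i) borel (\<lambda>\<omega>. pochhammer (?S \<omega>) l)" for i l
      by (rule indep_var_compose[unfolded comp_def]) measurable
    have g_int: "integrable M (?g i)" for i
      using Suc by (intro indep_var_integrable[OF ind] Ys_int) auto
    have g_exp: "expectation (?g i) = (fact i * ?F $ i) * (fact (m - i) * (?F ^ k) $ (m - i))" for i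
      using Suc Ys_exp[of "Suc k" i] by (subst indep_var_lebesgue_integral[OF ind]) (auto intro: Ys_int)
    \<comment> \<open>Vandermonde's identity for rising factorials separates the new summand from
      the earlier ones.\<close>
    have expand: "pochhammer (\<Sum>j=1..Suc k. Ys j \<omega>) m = (\<Sum>i\<le>m. real (m choose i) * ?g i \<omega>)" for \<omega>
      by (simp add: add.commute[of _ "Ys (Suc k) \<omega>"] pochhammer_binomial_sum mult.assoc)
    have "expectation (\<lambda>\<omega>. \<Sum>i\<le>m. real (m choose i) * ?g i \<omega>)
        = (\<Sum>i\<le>m. real (m choose i) * expectation (?g i))"
      using g_int by (subst Bochner_Integration.integral_sum) auto
    \<comment> \<open>The binomial coefficient times \<open>fact i * fact (m - i)\<close> is
      \<open>fact m\<close>, so a Cauchy product of coefficients remains.\<close>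
    also have "\<dots> = (\<Sum>i\<le>m. fact m * (?F $ i * (?F ^ k) $ (m - i)))"
      unfolding g_exp by (intro sum.cong refl) (simp add: binomial_fact)
    also have "\<dots> = fact m * (?F ^ Suc k) $ m"
      by (simp add: fps_mult_nth sum_distrib_left atLeast0AtMost)
    finally show ?case
      unfolding expand using g_int by auto
  qed
  thus "integrable M (\<lambda>\<omega>. pochhammer (\<Sum>j=1..k. Ys j \<omega>) m)"
    and "expectation (\<lambda>\<omega>. pochhammer (\<Sum>j=1..k. Ys j \<omega>) m) = fact m * (?F ^ k) $ m"
    by blast+
qed

end

section \<open>Exponential sums over powers of a formal power series\<close>

text \<open>The terms with \<open>k < j\<close> vanish; after the shift to \<open>k + j\<close> the
  binomial coefficient cancels \<open>fact (k + j)\<close>, leaving \<open>x ^ j / fact j\<close>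
  times the exponential series.\<close>

lemma sums_power_binomial_over_fact:
  fixes x :: real
  shows "(\<lambda>k. x ^ k / fact k * real (k choose j)) sums (x ^ j / fact j * exp x)"
proof -
  have "(\<lambda>k. x ^ j / fact j * (x ^ k / fact k)) sums (x ^ j / fact j * exp x)"
    using exp_converges[of x] by (intro sums_mult) (simp add: field_simps)
  also have "(\<lambda>k. x ^ j / fact j * (x ^ k / fact k)) =
      (\<lambda>k. x ^ (k + j) / fact (k + j) * real ((k + j) choose j))"
    by (simp add: fun_eq_iff binomial_fact power_add)
  finally show ?thesis
    by (subst (asm) sums_iff_shift) (simp add: binomial_eq_0)
qed

text \<open>Expanding around 1 gives a sum over \<open>j \<le> n\<close> whose range does not depend
  on \<open>k\<close>, so the series over \<open>k\<close> can be summed separately for each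
  \<open>j\<close>.\<close>

lemma sums_power_fps_nth_over_fact:
  fixes F :: "real fps" and x :: real
  assumes "F $ 0 = 1"
  shows "(\<lambda>k. x ^ k / fact k * (F ^ k) $ n) sums
    (exp x * (\<Sum>j\<le>n. ((F - 1) ^ j) $ n * x ^ j / fact j))"
proof -
  have expand: "(F ^ k) $ n = (\<Sum>j\<le>n. real (k choose j) * ((F - 1) ^ j) $ n)" for k
  proof -
    have "F ^ k = ((F - 1) + 1) ^ k" by simp
    also have "\<dots> = (\<Sum>j\<le>k. of_nat (k choose j) * (F - 1) ^ j)"
      by (subst binomial_ring) simp
    finally have "(F ^ k) $ n = (\<Sum>j\<le>k. real (k choose j) * ((F - 1) ^ j) $ n)"
      by (simp add: fps_sum_nth flip: fps_of_nat)
    \<comment> \<open>Passing through \<open>max k n\<close> avoids comparing \<open>k\<close> with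
      \<open>n\<close>: terms with \<open>j > k\<close> have binomial coefficient 0, and for
      \<open>j > n\<close> the series \<open>(F - 1) ^ j\<close> has no \<open>n\<close>-th
      coefficient.\<close>
    also have "\<dots> = (\<Sum>j\<le>max k n. real (k choose j) * ((F - 1) ^ j) $ n)"
      by (intro sum.mono_neutral_left) (auto simp: binomial_eq_0)
    also have "\<dots> = (\<Sum>j\<le>n. real (k choose j) * ((F - 1) ^ j) $ n)"
      using startsby_zero_power_prefix[of "F - 1"] assms
      by (intro sum.mono_neutral_right) auto
    finally show ?thesis .
  qed
  have "(\<lambda>k. \<Sum>j\<le>n. x ^ k / fact k * real (k choose j) * ((F - 1) ^ j) $ n) sums
      (\<Sum>j\<le>n. x ^ j / fact j * exp x * ((F - 1) ^ j) $ n)"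
    by (intro sums_sum sums_mult2 sums_power_binomial_over_fact)
  thus ?thesis
    by (simp add: expand sum_distrib_left mult_ac)
qed

section \<open>Dobinski-type formula for the probabilistic Lah-Bell polynomials\<close>

theorem theorem2p4:
  fixes M :: "'a measure" and Y :: "'a \<Rightarrow> real" and Ys :: "nat \<Rightarrow> 'a \<Rightarrow> real"
    and S :: "nat \<Rightarrow> 'a \<Rightarrow> real" and r x :: real and n :: nat
  assumes "prob_space M"
    and "Y \<in> borel_measurable M"
    and "r > 0"
    and "\<And>t::real. \<bar>t\<bar> < r \<Longrightarrow> integrable M (\<lambda>\<omega>. exp (t * Y \<omega>))"
    and "prob_space.indep_vars M (\<lambda>_. borel) Ys {1..}"
    and "\<And>j. j \<ge> 1 \<Longrightarrow> distr M borel (Ys j) = distr M borel Y"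
    and "\<And>k \<omega>. S k \<omega> = (\<Sum>j=1..k. Ys j \<omega>)"
  shows "(\<forall>k. integrable M (\<lambda>\<omega>. pochhammer (S k \<omega>) n)) \<and>
         summable (\<lambda>k. x ^ k / fact k * (\<integral>\<omega>. pochhammer (S k \<omega>) n \<partial>M)) \<and>
         prob_Lah_Bell M Y n x =
           exp (- x) * (\<Sum>k. x ^ k / fact k * (\<integral>\<omega>. pochhammer (S k \<omega>) n \<partial>M))"
proof -
  interpret prob_space M by fact
  define F where "F = Abs_fps (\<lambda>m. expectation (\<lambda>\<omega>. pochhammer (Y \<omega>) m) / fact m)"
  have F0: "F $ 0 = 1"
    by (simp add: F_def prob_space)
  note int = integrable_pochhammer[OF assms(2-4)]
  have S_int: "integrable M (\<lambda>\<omega>. pochhammer (S k \<omega>) n)" for k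
    unfolding assms(7) by (rule integrable_pochhammer_sum[OF assms(2,5,6) int])
  have S_exp: "expectation (\<lambda>\<omega>. pochhammer (S k \<omega>) n) = fact n * (F ^ k) $ n" for k
    unfolding assms(7) F_def by (rule expectation_pochhammer_sum[OF assms(2,5,6) int])
  have Lah: "prob_Lah M Y n k = fact n / fact k * ((F - 1) ^ k) $ n" for k
  proof (rule prob_Lah_eq_fps_nth[OF _ F0])
    show "0 < 1 - exp (- r)" using \<open>r > 0\<close> by simp
    show "(\<lambda>m. F $ m * t ^ m) sums (\<integral>\<omega>. (1 / (1 - t)) powr Y \<omega> \<partial>M)"
      if "\<bar>t\<bar> < 1 - exp (- r)" for t
      using sums_expectation_pochhammer[OF assms(2-4) that] by (simp add: F_def)
  qed
  \<comment> \<open>The factor \<open>fact n\<close> turns the coefficients of \<open>F ^ k\<close>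
    into the moments of \<open>S k\<close>, and those of \<open>(F - 1) ^ j\<close> over
    \<open>fact j\<close> into Lah numbers.\<close>
  have "(\<lambda>k. fact n * (x ^ k / fact k * (F ^ k) $ n)) sums
      (fact n * (exp x * (\<Sum>j\<le>n. ((F - 1) ^ j) $ n * x ^ j / fact j)))"
    by (intro sums_mult sums_power_fps_nth_over_fact F0)
  also have "fact n * (exp x * (\<Sum>j\<le>n. ((F - 1) ^ j) $ n * x ^ j / fact j)) =
      exp x * prob_Lah_Bell M Y n x"
    by (simp add: prob_Lah_Bell_def Lah sum_distrib_left atLeast0AtMost mult_ac)
  finally have "(\<lambda>k. x ^ k / fact k * expectation (\<lambda>\<omega>. pochhammer (S k \<omega>) n)) sums
      (exp x * prob_Lah_Bell M Y n x)"
    by (simp add: S_exp mult_ac)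
  thus ?thesis
    using S_int by (auto simp: sums_iff exp_minus)
qed

end
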